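(* Let $\emptyset\neq\mathcal{X}\subseteq\{0,1\}^n$ with $n\ge1$, $\hat c\in\mathbb{R}^n_{\ge0}$, and $B=\prod_{i=1}^n[-1,1]$ (constant growth). Then the variable-sized robust problem can be solved in time $O(nT)$, and the resulting set satisfies $|\mathcal{S}|\le n$.
   Context: For $\lambda\ge0$ let $\mathcal{U}_\lambda=\{\hat c\}+\lambda B$ and consider $\mathsf{P}(\lambda)$: $\min_{x\in\mathcal{X}}\max_{c\in\mathcal{U}_\lambda}c^tx$. Solving the variable-sized robust problem means computing a set $\mathcal{S}\subset\mathcal{X}$ of smallest possible size such that for every $\lambda\ge0$, $\mathcal{S}$ contains an optimal solution of $\mathsf{P}(\lambda)$. $T$ denotes the time necessary to solve the nominal problem $\min\{c^tx:x\in\mathcal{X}\}$ for a given nonnegative cost vector $c$. *)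

theory Defs
  imports Complex_Main
begin

subsection \<open>Variable-sized robust optimization\<close>

text \<open>The dimension is a parameter of the algorithm below, so a vector in \<open>\<real>\<^sup>n\<close> is a list of
  length \<open>n\<close>.\<close>

definition dot :: "real list \<Rightarrow> real list \<Rightarrow> real" where
  "dot c x = (\<Sum>i<length x. c ! i * x ! i)"

definition binary_vectors :: "nat \<Rightarrow> real list set" where
  "binary_vectors n = {x. length x = n \<and> set x \<subseteq> {0, 1}}"

definition nonneg_vectors :: "nat \<Rightarrow> real list set" where
  "nonneg_vectors n = {c. length c = n \<and> (\<forall>i<n. 0 \<le> c ! i)}"

definition unit_box :: "nat \<Rightarrow> real list set" where
  "unit_box n = {b. length b = n \<and> (\<forall>i<n. b ! i \<in> {-1..1})}"

definition uncertainty_set :: "real list \<Rightarrow> real list set \<Rightarrow> real \<Rightarrow> real list set" where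
  "uncertainty_set chat B lam = {map2 (\<lambda>c b. c + lam * b) chat b | b. b \<in> B}"

text \<open>For compact \<open>B\<close> the supremum is attained, i.e. it is the maximum over the uncertainty set.\<close>

definition worst_case_cost :: "real list set \<Rightarrow> real list \<Rightarrow> real" where
  "worst_case_cost U x = (SUP c\<in>U. dot c x)"

definition nominal_optimal :: "real list set \<Rightarrow> real list \<Rightarrow> real list \<Rightarrow> bool" where
  "nominal_optimal X c x \<longleftrightarrow> is_arg_min (dot c) (\<lambda>x. x \<in> X) x"

definition robust_optimal ::
  "real list set \<Rightarrow> real list \<Rightarrow> real list set \<Rightarrow> real \<Rightarrow> real list \<Rightarrow> bool" where
  "robust_optimal X chat B lam x \<longleftrightarrow>
     is_arg_min (worst_case_cost (uncertainty_set chat B lam)) (\<lambda>x. x \<in> X) x"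

definition covers_all_sizes ::
  "real list set \<Rightarrow> real list \<Rightarrow> real list set \<Rightarrow> real list set \<Rightarrow> bool" where
  "covers_all_sizes X chat B S \<longleftrightarrow>
     S \<subseteq> X \<and> (\<forall>lam\<ge>0. \<exists>x\<in>S. robust_optimal X chat B lam x)"

definition variable_sized_solution ::
  "real list set \<Rightarrow> real list \<Rightarrow> real list set \<Rightarrow> real list set \<Rightarrow> bool" where
  "variable_sized_solution X chat B S \<longleftrightarrow>
     covers_all_sizes X chat B S \<and> (\<forall>S'. covers_all_sizes X chat B S' \<longrightarrow> card S \<le> card S')"


subsection \<open>A real RAM with a subroutine for the nominal problem\<close>

text \<open>Running times refer to a structured real RAM: index registers hold natural numbers (addition
  and truncated subtraction only), arrays hold exact real numbers, and every elementary operation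
  has unit cost. There is no rounding and no conversion from reals to indices.\<close>

type_synonym vname = string

record state =
  reg :: "vname \<Rightarrow> nat"
  arr :: "vname \<Rightarrow> nat \<Rightarrow> real"

datatype iexp = IConst nat | IReg vname | IPlus iexp iexp | IMinus iexp iexp

datatype rexp = RConst int | RCell vname iexp
  | RPlus rexp rexp | RMinus rexp rexp | RTimes rexp rexp | RDiv rexp rexp

datatype bexp = ILess iexp iexp | RLess rexp rexp | BNot bexp | BAnd bexp bexp

datatype com = Skip
  | IAssign vname iexp
  | RAssign vname iexp rexp \<comment> \<open>\<open>RAssign a i e\<close> writes the value of \<open>e\<close> to cell \<open>i\<close> of array \<open>a\<close>\<close>
  | Seq com com
  | Cond bexp com com
  | While bexp com
  | Solve \<comment> \<open>call of the subroutine for the nominal problem\<close>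

primrec ival :: "iexp \<Rightarrow> state \<Rightarrow> nat" where
  "ival (IConst k) s = k"
| "ival (IReg v) s = reg s v"
| "ival (IPlus e f) s = ival e s + ival f s"
| "ival (IMinus e f) s = ival e s - ival f s"

primrec rval :: "rexp \<Rightarrow> state \<Rightarrow> real" where
  "rval (RConst k) s = of_int k"
| "rval (RCell a e) s = arr s a (ival e s)"
| "rval (RPlus e f) s = rval e s + rval f s"
| "rval (RMinus e f) s = rval e s - rval f s"
| "rval (RTimes e f) s = rval e s * rval f s"
| "rval (RDiv e f) s = rval e s / rval f s"

primrec bval :: "bexp \<Rightarrow> state \<Rightarrow> bool" where
  "bval (ILess e f) s \<longleftrightarrow> ival e s < ival f s"
| "bval (RLess e f) s \<longleftrightarrow> rval e s < rval f s"
| "bval (BNot b) s \<longleftrightarrow> \<not> bval b s"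
| "bval (BAnd b d) s \<longleftrightarrow> bval b s \<and> bval d s"

primrec icost :: "iexp \<Rightarrow> nat" where
  "icost (IConst k) = 1"
| "icost (IReg v) = 1"
| "icost (IPlus e f) = 1 + icost e + icost f"
| "icost (IMinus e f) = 1 + icost e + icost f"

primrec rcost :: "rexp \<Rightarrow> nat" where
  "rcost (RConst k) = 1"
| "rcost (RCell a e) = 1 + icost e"
| "rcost (RPlus e f) = 1 + rcost e + rcost f"
| "rcost (RMinus e f) = 1 + rcost e + rcost f"
| "rcost (RTimes e f) = 1 + rcost e + rcost f"
| "rcost (RDiv e f) = 1 + rcost e + rcost f"

primrec bcost :: "bexp \<Rightarrow> nat" where
  "bcost (ILess e f) = 1 + icost e + icost f"
| "bcost (RLess e f) = 1 + rcost e + rcost f"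
| "bcost (BNot b) = 1 + bcost b"
| "bcost (BAnd b d) = 1 + bcost b + bcost d"

text \<open>\<open>exec R c s t s'\<close>: started in \<open>s\<close>, the program \<open>c\<close> halts after \<open>t\<close> steps in \<open>s'\<close>, where the
  relation \<open>R\<close> is the (timed) behaviour of the subroutine. The subroutine has its own copies of all
  variables: it reads its input from \<open>n\<close> and \<open>c\<close>, and only array \<open>x\<close> is handed back.\<close>

inductive exec ::
  "(state \<Rightarrow> nat \<Rightarrow> state \<Rightarrow> bool) \<Rightarrow> com \<Rightarrow> state \<Rightarrow> nat \<Rightarrow> state \<Rightarrow> bool"
  for R :: "state \<Rightarrow> nat \<Rightarrow> state \<Rightarrow> bool" where
  exec_Skip: "exec R Skip s 1 s"
| exec_IAssign: "exec R (IAssign v e) s (1 + icost e) (s\<lparr>reg := (reg s)(v := ival e s)\<rparr>)"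
| exec_RAssign: "exec R (RAssign a i e) s (1 + icost i + rcost e)
    (s\<lparr>arr := (arr s)(a := (arr s a)(ival i s := rval e s))\<rparr>)"
| exec_Seq: "exec R c s t s' \<Longrightarrow> exec R d s' u s'' \<Longrightarrow> exec R (Seq c d) s (t + u) s''"
| exec_CondTrue: "bval b s \<Longrightarrow> exec R c s t s' \<Longrightarrow> exec R (Cond b c d) s (1 + bcost b + t) s'"
| exec_CondFalse: "\<not> bval b s \<Longrightarrow> exec R d s t s' \<Longrightarrow> exec R (Cond b c d) s (1 + bcost b + t) s'"
| exec_WhileFalse: "\<not> bval b s \<Longrightarrow> exec R (While b c) s (1 + bcost b) s"
| exec_WhileTrue: "bval b s \<Longrightarrow> exec R c s t s' \<Longrightarrow> exec R (While b c) s' u s'' \<Longrightarrow>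
    exec R (While b c) s (1 + bcost b + t + u) s''"
| exec_Solve: "R s t s' \<Longrightarrow>
    exec R Solve s (1 + t) (s\<lparr>arr := (arr s)(''x'' := arr s' ''x'')\<rparr>)"

lemma exec_deterministic:
  assumes "\<And>s t s' u s''. R s t s' \<Longrightarrow> R s u s'' \<Longrightarrow> t = u \<and> s' = s''"
  shows "exec R c s t s' \<Longrightarrow> exec R c s u s'' \<Longrightarrow> t = u \<and> s' = s''"
proof (induction arbitrary: u s'' rule: exec.induct)
  case (exec_Seq c s t s' d v s2)
  from exec_Seq.prems show ?case
    by cases (use exec_Seq.IH in blast)
next
  case (exec_WhileTrue b s c t s' v s2)
  from exec_WhileTrue.prems show ?case
    by cases (use exec_WhileTrue.IH exec_WhileTrue.hyps in blast)+
next
  case (exec_Solve s t s')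
  from exec_Solve.prems show ?case
    by cases (use assms exec_Solve.hyps in blast)
qed (erule exec.cases; blast)+

abbreviation exec_basic :: "com \<Rightarrow> state \<Rightarrow> nat \<Rightarrow> state \<Rightarrow> bool" where
  "exec_basic \<equiv> exec (\<lambda>_ _ _. False)"

definition vector_in :: "state \<Rightarrow> vname \<Rightarrow> nat \<Rightarrow> real list" where
  "vector_in s a n = map (arr s a) [0..<n]"

text \<open>\<open>Q\<close> solves the nominal problem over \<open>X\<close> for all nonnegative costs in time \<open>T\<close>. Since \<open>s\<close> is
  arbitrary apart from the input, \<open>Q\<close> has to write all \<open>n\<close> cells of the solution, so \<open>n \<le> T\<close>.\<close>

definition solves_nominal :: "com \<Rightarrow> nat \<Rightarrow> real list set \<Rightarrow> nat \<Rightarrow> bool" where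
  "solves_nominal Q n X T \<longleftrightarrow>
     (\<forall>s. reg s ''n'' = n \<and> vector_in s ''c'' n \<in> nonneg_vectors n \<longrightarrow>
       (\<exists>t s'. exec_basic Q s t s' \<and> t \<le> T \<and>
          nominal_optimal X (vector_in s ''c'' n) (vector_in s' ''x'' n)))"

text \<open>A set of \<open>m\<close> vectors is output by storing \<open>m\<close> in a register and the vectors, without
  repetitions, as consecutive blocks of length \<open>n\<close> of an array.\<close>

definition outputs_set :: "state \<Rightarrow> nat \<Rightarrow> real list set \<Rightarrow> bool" where
  "outputs_set s n S \<longleftrightarrow>
     S = (\<lambda>i. map (\<lambda>j. arr s ''S'' (i * n + j)) [0..<n]) ` {..<reg s ''m''} \<and>
     card S = reg s ''m''"

end

theory Submission
  imports Defs
begin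

text \<open>For binary \<open>x\<close> the worst case over \<open>\<U>\<^sub>\<lambda>\<close> is attained at \<open>c + \<lambda>(1, \<dots>, 1)\<close>, so \<open>\<P>(\<lambda>)\<close> minimises the
  lines \<open>\<lambda> \<mapsto> cx + \<lambda>|x|\<close>, whose slopes are integers between \<open>0\<close> and \<open>n\<close>. The sweep traverses their
  lower envelope from \<open>\<lambda> = 1 + \<Sum>c\<close>, beyond which it is a single line, down to \<open>\<lambda> = 0\<close>. It keeps a stack
  of solutions known to be optimal further left, with an optimum for \<open>\<lambda> = 0\<close> at the bottom. The
  nominal problem is solved where the line of the current solution \<open>x\<close> meets the line of the top of
  the stack: a strictly better solution is pushed, otherwise the top replaces \<open>x\<close>, which is kept only
  if it is optimal on a nondegenerate interval. With \<open>h\<close> the height of the stack, each round decreases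
  \<open>2(n - |x|) - h\<close>, which is at most \<open>2n\<close> and stays nonnegative because the slopes strictly increase
  from \<open>x\<close> downwards through the stack. Inside a nondegenerate interval all optima have the
  same slope, so every covering set has at least as many elements as the output. The bound
  \<open>n\<close> rather than \<open>n + 1\<close> holds because the zero vector, if feasible, is optimal for all \<open>\<lambda>\<close>.\<close>

subsection \<open>Lower envelopes of lines with integral slopes\<close>

locale parametric_min =
  fixes X :: "'a set" and a :: "'a \<Rightarrow> real" and w :: "'a \<Rightarrow> nat"
begin

definition cost :: "real \<Rightarrow> 'a \<Rightarrow> real" where
  "cost \<theta> x = a x + \<theta> * w x"

definition opt :: "real \<Rightarrow> 'a \<Rightarrow> bool" where
  "opt \<theta> x \<longleftrightarrow> x \<in> X \<and> (\<forall>y\<in>X. cost \<theta> x \<le> cost \<theta> y)"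

text \<open>At the witnessing parameter all optima share one slope, so every covering set must
  contain an element of that slope. This is the source of the lower bound on the size of a
  solution.\<close>

definition essential :: "'a \<Rightarrow> bool" where
  "essential x \<longleftrightarrow> (\<exists>\<theta>\<ge>0. opt \<theta> x \<and> (\<forall>z. opt \<theta> z \<longrightarrow> w x = w z))"

definition covers_from :: "real \<Rightarrow> 'a set \<Rightarrow> bool" where
  "covers_from b A \<longleftrightarrow> (\<forall>\<theta>\<ge>b. \<exists>x\<in>A. opt \<theta> x)"

lemma opt_in: "opt \<theta> x \<Longrightarrow> x \<in> X"
  by (simp add: opt_def)

lemma opt_le: "opt \<theta> x \<Longrightarrow> y \<in> X \<Longrightarrow> cost \<theta> x \<le> cost \<theta> y"
  by (simp add: opt_def)

lemma opt_cong: "opt \<theta> x \<Longrightarrow> y \<in> X \<Longrightarrow> cost \<theta> y \<le> cost \<theta> x \<Longrightarrow> opt \<theta> y"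
  unfolding opt_def by force

text \<open>The difference of two costs is affine in the parameter. The sign of the slope difference
  decides which end of the interval implies the inequality inside.\<close>

lemma cost_between:
  assumes "\<mu> \<le> \<theta>" "\<theta> \<le> \<nu>" "cost \<mu> x \<le> cost \<mu> y" "cost \<nu> x \<le> cost \<nu> y"
  shows "cost \<theta> x \<le> cost \<theta> y"
proof (cases "w x \<le> w y")
  case True
  then have "\<mu> * (real (w y) - w x) \<le> \<theta> * (real (w y) - w x)"
    using assms(1) by (intro mult_right_mono) auto
  then show ?thesis using assms(3) by (simp add: cost_def algebra_simps)
next
  case False
  then have "\<theta> * (real (w x) - w y) \<le> \<nu> * (real (w x) - w y)"
    using assms(2) by (intro mult_right_mono) auto
  then show ?thesis using assms(4) by (simp add: cost_def algebra_simps)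
qed

lemma opt_between:
  "opt \<mu> x \<Longrightarrow> opt \<nu> x \<Longrightarrow> \<mu> \<le> \<theta> \<Longrightarrow> \<theta> \<le> \<nu> \<Longrightarrow> opt \<theta> x"
  by (meson cost_between opt_def)

lemma covers_from_extend:
  assumes "covers_from \<nu> A" "x \<in> A" "opt \<mu> x" "opt \<nu> x"
  shows "covers_from \<mu> A"
  using assms opt_between[OF assms(3,4)] unfolding covers_from_def by (meson linear)

text \<open>Subtracting the two inequalities gives \<open>(\<nu> - \<mu>) * (w y - w x) > 0\<close>:
  a line that wins strictly on the left but not on the right is the steeper one.\<close>

lemma slope_less:
  assumes "\<mu> \<le> \<nu>" "cost \<mu> y < cost \<mu> x" "cost \<nu> x \<le> cost \<nu> y"
  shows "\<mu> < \<nu> \<and> w x < w y"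
proof -
  have "(\<nu> - \<mu>) * (real (w y) - w x) > 0"
    using assms(2,3) by (simp add: cost_def algebra_simps)
  then show ?thesis using assms(1) by (auto simp: zero_less_mult_iff)
qed

text \<open>The midpoint is the witness. For an optimum \<open>z\<close> there, the affine
  difference to \<open>x\<close> vanishes at the midpoint and is nonnegative at both ends, hence is
  zero at both ends, and the slopes agree.\<close>

lemma essentialI:
  assumes "opt \<mu> x" "opt \<nu> x" "0 \<le> \<mu>" "\<mu> < \<nu>"
  shows "essential x"
  unfolding essential_def
proof (intro exI[of _ "(\<mu> + \<nu>) / 2"] conjI allI impI)
  let ?\<theta> = "(\<mu> + \<nu>) / 2"
  show "opt ?\<theta> x" using assms by (intro opt_between[OF assms(1,2)]) auto
  fix z assume "opt ?\<theta> z"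
  then have "cost ?\<theta> z = cost ?\<theta> x" "z \<in> X"
    using \<open>opt ?\<theta> x\<close> by (auto simp: opt_def intro: antisym)
  moreover have "cost \<mu> x \<le> cost \<mu> z" "cost \<nu> x \<le> cost \<nu> z"
    using assms \<open>z \<in> X\<close> by (auto simp: opt_def)
  ultimately have "(\<nu> - \<mu>) * (real (w z) - w x) = 0"
    by (simp add: cost_def field_simps)
  then show "w x = w z" using assms(4) by simp
qed (use assms in auto)

text \<open>At the parameter that makes \<open>x\<close> essential, \<open>S'\<close> offers an
  optimum, and its slope is \<open>w x\<close>. So the slopes of \<open>S\<close>, which are
  pairwise distinct, all occur in \<open>S'\<close>.\<close>

lemma card_le_covering:
  assumes "\<And>x. x \<in> S \<Longrightarrow> essential x" "inj_on w S" "covers_from 0 S'" "finite S'"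
  shows "card S \<le> card S'"
proof -
  have "w ` S \<subseteq> w ` S'"
    using assms(1,3) unfolding essential_def covers_from_def by (metis image_eqI image_subsetI)
  then have "card (w ` S) \<le> card (w ` S')"
    using assms(4) by (simp add: card_mono)
  also have "\<dots> \<le> card S'" using assms(4) by (rule card_image_le)
  finally show ?thesis using assms(2) by (simp add: card_image)
qed

text \<open>By the last disjunction, a tie at \<open>b\<close> can only occur when \<open>x\<close> is dispensable: \<open>x\<close> is overwritten
  if the next crossing is again at \<open>b\<close>.\<close>

definition front_inv :: "'a list \<Rightarrow> 'a \<Rightarrow> real \<Rightarrow> bool" where
  "front_inv L x b \<longleftrightarrow> 0 < b \<and> opt b x \<and> (\<forall>y\<in>set L. essential y) \<and>
     sorted_wrt (\<lambda>y z. w y < w z) (L @ [x]) \<and> covers_from b (insert x (set L)) \<and>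
     (covers_from b (set L) \<or> (\<forall>z. opt b z \<longrightarrow> w x = w z))"

text \<open>The stack grows at the tail of the list: \<open>hd R\<close> is its bottom and
  \<open>last R\<close> its top. Slopes therefore increase along \<open>x # rev R\<close>.\<close>

definition stack_inv :: "'a \<Rightarrow> 'a list \<Rightarrow> bool" where
  "stack_inv x R \<longleftrightarrow> R \<noteq> [] \<and> opt 0 (hd R) \<and> (\<forall>y\<in>set R. \<exists>\<nu>\<ge>0. opt \<nu> y) \<and>
     sorted_wrt (\<lambda>y z. w y < w z) (x # rev R)"

definition crossing :: "'a \<Rightarrow> 'a \<Rightarrow> real" where
  "crossing x y = (a x - a y) / (real (w y) - real (w x))"

text \<open>No line is flatter than that of \<open>x\<close>, so once optimal at \<open>b\<close> it
  is never undercut further right. Uniqueness of the slope at \<open>b\<close> supplies the second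
  alternative of the tie clause.\<close>

lemma front_inv_init:
  assumes "0 < b" "\<And>y. y \<in> X \<Longrightarrow> w x \<le> w y" "opt b x" "\<And>z. opt b z \<Longrightarrow> w x = w z"
  shows "front_inv [] x b"
proof -
  have "opt \<theta> x" if "b \<le> \<theta>" for \<theta>
    unfolding opt_def
  proof (intro conjI ballI)
    show "x \<in> X" using assms(3) by (rule opt_in)
    fix y assume "y \<in> X"
    then have "cost b x \<le> cost b y" "(\<theta> - b) * (real (w y) - w x) \<ge> 0"
      using assms(2,3) that by (auto simp: opt_def)
    then show "cost \<theta> x \<le> cost \<theta> y" by (simp add: cost_def algebra_simps)
  qed
  then have "covers_from b {x}" by (simp add: covers_from_def)
  then have "front_inv [] x b \<longleftrightarrow> covers_from b {} \<or> (\<forall>z. opt b z \<longrightarrow> w x = w z)"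
    using assms(1,3) by (simp add: front_inv_def)
  then show ?thesis using assms(4) by blast
qed

lemma stack_inv_init:
  assumes "opt b x" "0 < b" "opt 0 y" "\<not> opt 0 x"
  shows "stack_inv x [y]"
proof -
  have "cost 0 y < cost 0 x"
    using opt_cong[OF assms(3) opt_in[OF assms(1)]] assms(4) by force
  then have "w x < w y"
    using slope_less[of 0 b y x] assms opt_le opt_in by (meson less_imp_le)
  then show ?thesis using assms(3) by (auto simp: stack_inv_def)
qed

section \<open>One round: the crossing of the current solution with the top of the stack\<close>

context
  fixes L x b R
  assumes front: "front_inv L x b" and stack: "stack_inv x R" and not_opt: "\<not> opt 0 x"
begin

lemma opt_b: "opt b x" and b_pos: "0 < b"
  using front by (auto simp: front_inv_def)

lemma top_in: "last R \<in> set R"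
  using stack by (simp add: stack_inv_def)

lemma stack_slopes: "y \<in> set R \<Longrightarrow> w x < w y"
  using stack by (simp add: stack_inv_def)

lemma top_opt: "\<exists>\<nu>\<ge>0. opt \<nu> (last R)"
  using top_in stack by (auto simp: stack_inv_def)

lemma top_in_X: "last R \<in> X"
  using top_opt opt_in by blast

text \<open>Otherwise the steeper top would be strictly dearer than \<open>x\<close> at every
  positive parameter. It could then be optimal only at 0, where \<open>x\<close> would be optimal as
  well.\<close>

lemma top_less: "a (last R) < a x"
proof (rule ccontr)
  assume "\<not> ?thesis"
  then have le: "a x \<le> a (last R)" by simp
  obtain \<nu> where \<nu>: "\<nu> \<ge> 0" "opt \<nu> (last R)" using top_opt by blast
  have "cost \<nu> (last R) \<le> cost \<nu> x" using \<nu>(2) opt_b opt_in opt_le by blast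
  then have "\<nu> * (real (w (last R)) - w x) \<le> 0"
    using le by (simp add: cost_def algebra_simps)
  then have "\<nu> = 0" using \<nu>(1) stack_slopes[OF top_in] by (auto simp: mult_le_0_iff)
  then have "opt 0 x"
    using opt_cong[OF _ opt_in[OF opt_b], of 0 "last R"] \<nu>(2) le by (simp add: cost_def)
  then show False using not_opt by simp
qed

lemma cost_crossing: "cost (crossing x (last R)) (last R) = cost (crossing x (last R)) x"
  using stack_slopes[OF top_in] by (simp add: cost_def crossing_def field_simps)

lemma crossing_pos: "0 < crossing x (last R)"
  using stack_slopes[OF top_in] top_less by (simp add: crossing_def)

text \<open>At \<open>b\<close> the steeper top costs at least as much as \<open>x\<close>, so the
  lines have met by then. Together with \<open>crossing_pos\<close> this keeps the sweep within the
  parameters between 0 and \<open>b\<close>.\<close>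

lemma crossing_le: "crossing x (last R) \<le> b"
  using stack_slopes[OF top_in] opt_le[OF opt_b top_in_X]
  by (simp add: crossing_def cost_def field_simps)

lemma le_crossing: "opt \<nu> (last R) \<Longrightarrow> \<nu> \<le> crossing x (last R)"
  using stack_slopes[OF top_in] opt_le[OF _ opt_in[OF opt_b], of \<nu> "last R"]
  by (simp add: crossing_def cost_def field_simps)

text \<open>The slope of \<open>z\<close> lies strictly between those of \<open>x\<close> and the
  top. At the crossing \<open>z\<close> beats both, but it does not beat \<open>x\<close> further
  right at \<open>b\<close>, nor the top further left where the top is optimal.\<close>

lemma stack_inv_push:
  assumes "opt (crossing x (last R)) z"
    and less: "cost (crossing x (last R)) z < cost (crossing x (last R)) x"
  shows "stack_inv x (R @ [z])"
proof -
  let ?\<theta> = "crossing x (last R)"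
  have z: "z \<in> X" using assms(1) by (rule opt_in)
  have 1: "w x < w z" using slope_less[OF crossing_le less opt_le[OF opt_b z]] by simp
  obtain \<nu> where \<nu>: "\<nu> \<ge> 0" "opt \<nu> (last R)" using top_opt by blast
  have "cost ?\<theta> z < cost ?\<theta> (last R)" using less cost_crossing by simp
  moreover have "\<not> w (last R) \<le> w z"
  proof
    assume le: "w (last R) \<le> w z"
    have "(?\<theta> - \<nu>) * (real (w z) - w (last R)) \<ge> 0"
      using le le_crossing[OF \<nu>(2)] by simp
    then show False
      using opt_le[OF \<nu>(2) z] calculation by (simp add: cost_def algebra_simps)
  qed
  ultimately have 2: "w z < w (last R)" by simp
  have "R = butlast R @ [last R]" using stack by (simp add: stack_inv_def)
  then have 3: "rev R = last R # rev (butlast R)" by (metis rev_eq_Cons_iff rev_rev_ident)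
  \<comment> \<open>The top heads \<open>rev R\<close> and so has the least slope on the stack;
    being flatter than the top is enough.\<close>
  have "\<forall>y\<in>set R. w z < w y"
    using stack 2 unfolding stack_inv_def 3 by (metis "3" less_trans list.set_intros(1) set_ConsD set_rev sorted_wrt.simps(2))
  then show ?thesis
    using stack 1 assms(1) less_imp_le[OF crossing_pos] by (auto simp: stack_inv_def)
qed

context
  assumes no_better: "opt (crossing x (last R)) x"
begin

lemma top_opt_crossing: "opt (crossing x (last R)) (last R)"
  using opt_cong[OF no_better top_in_X] cost_crossing by simp

lemma sorted_top:
  "sorted_wrt (\<lambda>y z. w y < w z) (L @ [x, last R])" "sorted_wrt (\<lambda>y z. w y < w z) (L @ [last R])"
proof -
  have "sorted_wrt (\<lambda>y z. w y < w z) (L @ [x])" using front by (simp add: front_inv_def)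
  then show "sorted_wrt (\<lambda>y z. w y < w z) (L @ [x, last R])"
    "sorted_wrt (\<lambda>y z. w y < w z) (L @ [last R])"
    using stack_slopes[OF top_in] by (auto simp: sorted_wrt_append intro: less_trans)
qed

text \<open>\<open>x\<close> is optimal at the crossing and at \<open>b\<close>, now distinct, so it
  is essential and covers the gap between them. Hence the extended list covers from the crossing
  onwards, the first alternative of the tie clause.\<close>

lemma front_inv_append:
  assumes "crossing x (last R) < b"
  shows "front_inv (L @ [x]) (last R) (crossing x (last R))"
proof -
  have "essential x" using essentialI[OF no_better opt_b] crossing_pos assms by simp
  moreover have "covers_from (crossing x (last R)) (insert x (set L))"
    using front covers_from_extend[OF _ _ no_better opt_b] by (simp add: front_inv_def)
  ultimately show ?thesis
    using front top_opt_crossing crossing_pos sorted_top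
    by (auto simp: front_inv_def covers_from_def)
qed

lemma front_inv_replace:
  assumes "\<not> crossing x (last R) < b"
  shows "front_inv L (last R) (crossing x (last R))"
proof -
  have eq: "crossing x (last R) = b" using assms crossing_le by simp
  then have "covers_from b (set L)"
    using front top_opt_crossing stack_slopes[OF top_in] by (auto simp: front_inv_def)
  then show ?thesis
    using front top_opt_crossing b_pos sorted_top
    unfolding front_inv_def eq by (auto simp: covers_from_def)
qed

text \<open>The bottom is optimal at 0 and the top is not, so they differ and the bottom survives
  the removal.\<close>

lemma stack_inv_pop:
  assumes "\<not> opt 0 (last R)"
  shows "stack_inv (last R) (butlast R)"
proof -
  have R: "R = butlast R @ [last R]" using stack by (simp add: stack_inv_def)
  then have 3: "rev R = last R # rev (butlast R)" by (metis rev_eq_Cons_iff rev_rev_ident)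
  have "butlast R \<noteq> []"
    using R assms stack by (metis append_Nil list.sel(1) stack_inv_def)
  moreover from this have "hd (butlast R) = hd R" by (metis R hd_append2)
  ultimately show ?thesis
    using stack 3 by (auto simp: stack_inv_def dest: in_set_butlastD)
qed

end
end

text \<open>Since \<open>b\<close> is positive, optimality at 0 and at \<open>b\<close> makes
  \<open>x\<close> essential, and \<open>x\<close> covers everything from 0 to
  \<open>b\<close>.\<close>

lemma front_inv_final:
  assumes "front_inv L x b" "opt 0 x"
  shows "covers_from 0 (set (L @ [x]))" "\<forall>y\<in>set (L @ [x]). essential y"
proof -
  have b: "opt b x" "0 < b" using assms(1) by (auto simp: front_inv_def)
  show "covers_from 0 (set (L @ [x]))"
    using assms(1) covers_from_extend[OF _ _ assms(2) b(1)] by (simp add: front_inv_def)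
  show "\<forall>y\<in>set (L @ [x]). essential y"
    using essentialI[OF assms(2) b(1)] b assms(1) by (auto simp: front_inv_def)
qed

lemma sorted_slopes_inj:
  "sorted_wrt (\<lambda>y z. w y < w z) xs \<Longrightarrow> distinct xs \<and> inj_on w (set xs)"
proof (induction xs)
  case (Cons y ys)
  then have "w z \<noteq> w y" if "z \<in> set ys" for z using that by fastforce
  then have "w y \<notin> w ` set ys" by force
  then show ?case using Cons by (auto simp: image_iff)
qed simp

text \<open>Strictly increasing integers between \<open>m\<close> and \<open>n\<close> are few. With
  \<open>m\<close> the weight of \<open>x\<close> this bounds the stack height, with
  \<open>m = 1\<close> the size of the output.\<close>

lemma sorted_slopes_length:
  assumes "sorted_wrt (\<lambda>y z. w y < w z) xs" "\<forall>y\<in>set xs. m \<le> w y \<and> w y \<le> n"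
  shows "length xs \<le> Suc n - m"
proof -
  have "length xs = card (w ` set xs)"
    using sorted_slopes_inj[OF assms(1)] by (simp add: card_image distinct_card)
  also have "\<dots> \<le> card {m..n}" using assms(2) by (intro card_mono) auto
  finally show ?thesis by simp
qed

end

subsection \<open>Timed total correctness on the real RAM\<close>

text \<open>The postcondition also receives the elapsed time, so rules compose by adding times
  inside it. Asking for some run is total correctness here because \<open>exec_basic Q\<close>, and
  hence execution on top of it, is deterministic.\<close>

definition runs ::
  "(state \<Rightarrow> nat \<Rightarrow> state \<Rightarrow> bool) \<Rightarrow> com \<Rightarrow> state \<Rightarrow> (nat \<Rightarrow> state \<Rightarrow> bool) \<Rightarrow> bool" where
  "runs R c s \<Phi> \<longleftrightarrow> (\<exists>u s'. exec R c s u s' \<and> \<Phi> u s')"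

lemma runsI: "exec R c s u s' \<Longrightarrow> \<Phi> u s' \<Longrightarrow> runs R c s \<Phi>"
  unfolding runs_def by blast

lemma runs_mono:
  "runs R c s \<Phi> \<Longrightarrow> (\<And>u s'. \<Phi> u s' \<Longrightarrow> \<Psi> u s') \<Longrightarrow> runs R c s \<Psi>"
  unfolding runs_def by blast

lemma runs_Skip: "\<Phi> 1 s \<Longrightarrow> runs R Skip s \<Phi>"
  unfolding runs_def by (blast intro: exec_Skip)

definition set_reg :: "vname \<Rightarrow> nat \<Rightarrow> state \<Rightarrow> state" where
  "set_reg v k s = s\<lparr>reg := (reg s)(v := k)\<rparr>"

definition set_arr :: "vname \<Rightarrow> (nat \<Rightarrow> real) \<Rightarrow> state \<Rightarrow> state" where
  "set_arr a A s = s\<lparr>arr := (arr s)(a := A)\<rparr>"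

definition set_entry :: "vname \<Rightarrow> nat \<Rightarrow> real \<Rightarrow> state \<Rightarrow> state" where
  "set_entry a k r s = set_arr a ((arr s a)(k := r)) s"

lemma reg_set [simp]:
  "reg (set_reg v k s) = (reg s)(v := k)" "reg (set_arr a A s) = reg s"
  "reg (set_entry a j r s) = reg s"
  by (simp_all add: set_reg_def set_arr_def set_entry_def)

lemma arr_set [simp]:
  "arr (set_reg v k s) = arr s" "arr (set_arr a A s) = (arr s)(a := A)"
  "arr (set_entry a j r s) = (arr s)(a := (arr s a)(j := r))"
  by (simp_all add: set_reg_def set_arr_def set_entry_def)

lemma state_eqI: "reg s = reg s' \<Longrightarrow> arr s = arr s' \<Longrightarrow> s = (s' :: state)"
  by simp

lemma runs_IAssign:
  assumes "ival e s = k" "\<Phi> (1 + icost e) (set_reg v k s)"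
  shows "runs R (IAssign v e) s \<Phi>"
  by (rule runsI[OF exec_IAssign]) (use assms in \<open>simp add: set_reg_def\<close>)

lemma runs_RAssign:
  assumes "ival i s = k" "rval e s = r" "\<Phi> (1 + icost i + rcost e) (set_entry a k r s)"
  shows "runs R (RAssign a i e) s \<Phi>"
  by (rule runsI[OF exec_RAssign]) (use assms in \<open>simp add: set_entry_def set_arr_def\<close>)

lemma runs_Seq:
  "runs R c s (\<lambda>u s'. runs R d s' (\<lambda>v. \<Phi> (u + v))) \<Longrightarrow> runs R (Seq c d) s \<Phi>"
  unfolding runs_def by (blast intro: exec_Seq)

lemma runs_Cond:
  assumes "bval b s \<Longrightarrow> runs R c s (\<lambda>u. \<Phi> (1 + bcost b + u))"
    "\<not> bval b s \<Longrightarrow> runs R d s (\<lambda>u. \<Phi> (1 + bcost b + u))"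
  shows "runs R (Cond b c d) s \<Phi>"
  using assms unfolding runs_def by (cases "bval b s") (blast intro: exec_CondTrue exec_CondFalse)+

text \<open>The index \<open>k\<close> bounds the number of remaining iterations and falls by one in
  each. The body thus runs at most \<open>k\<close> times and the test at most \<open>Suc k\<close>
  times.\<close>

lemma runs_While:
  assumes step: "\<And>k s. I k s \<Longrightarrow> bval b s \<Longrightarrow>
      0 < k \<and> runs R c s (\<lambda>u s'. u \<le> t \<and> I (k - 1) s')"
    and "I k s"
    and post: "\<And>u k' s'. u \<le> k * t + Suc k * (1 + bcost b) \<Longrightarrow> \<not> bval b s' \<Longrightarrow> I k' s' \<Longrightarrow> \<Phi> u s'"
  shows "runs R (While b c) s \<Phi>"
  using assms(2,3)
proof (induction k arbitrary: s \<Phi>)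
  case 0
  then have "\<not> bval b s" using step by blast
  then show ?case by (intro runsI[OF exec_WhileFalse] 0(2)[of _ _ 0] 0(1)) auto
next
  case (Suc k)
  show ?case
  proof (cases "bval b s")
    case True
    obtain u s' where u: "exec R c s u s'" "u \<le> t" "I k s'"
      using step[OF Suc.prems(1) True] by (auto simp: runs_def)
    have "runs R (While b c) s' (\<lambda>v. \<Phi> (1 + bcost b + u + v))"
      by (rule Suc.IH[OF u(3)], rule Suc.prems(2)) (use u(2) in auto)
    then obtain v s'' where "exec R (While b c) s' v s''" "\<Phi> (1 + bcost b + u + v) s''"
      by (auto simp: runs_def)
    then show ?thesis using exec_WhileTrue[OF True u(1)] by (auto simp: runs_def)
  next
    case False
    then show ?thesis
      by (intro runsI[OF exec_WhileFalse] Suc.prems(2)[of _ _ "Suc k"] Suc.prems(1)) auto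
  qed
qed

section \<open>Loops over the coordinates\<close>

definition for_n :: "com \<Rightarrow> com" where
  "for_n c = Seq (IAssign ''i'' (IConst 0)) (While (ILess (IReg ''i'') (IReg ''n''))
     (Seq c (IAssign ''i'' (IPlus (IReg ''i'') (IConst 1)))))"

text \<open>Each iteration adds 4 steps for the increment and 4 for the test. The initial assignment
  (2) and the last test (4) are charged to the iterations, as \<open>1 \<le> n\<close>; this yields
  14.\<close>

lemma runs_for_n:
  assumes init: "I 0 (set_reg ''i'' 0 s)"
    and regs: "\<And>j s. I j s \<Longrightarrow> reg s ''i'' = j \<and> reg s ''n'' = n"
    and step: "\<And>j s. j < n \<Longrightarrow> I j s \<Longrightarrow>
      runs R c s (\<lambda>u s'. u \<le> t \<and> reg s' ''i'' = j \<and> I (Suc j) (set_reg ''i'' (Suc j) s'))"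
    and n: "1 \<le> n"
    and post: "\<And>u s'. u \<le> (t + 14) * n \<Longrightarrow> I n s' \<Longrightarrow> \<Phi> u s'"
  shows "runs R (for_n c) s \<Phi>"
  unfolding for_n_def
proof (rule runs_Seq, rule runs_IAssign, rule refl,
    rule runs_While[where I = "\<lambda>k s. k \<le> n \<and> I (n - k) s" and k = n and t = "t + 4"], goal_cases)
  case (1 k s)
  then have k: "0 < k" "n - k < n" using regs[of "n - k" s] by auto
  have "runs R (Seq c (IAssign ''i'' (IPlus (IReg ''i'') (IConst 1)))) s
      (\<lambda>u s'. u \<le> t + 4 \<and> k - 1 \<le> n \<and> I (n - (k - 1)) s')"
  proof (rule runs_Seq, rule runs_mono[OF step[OF k(2)]])
    show "I (n - k) s" using 1 by simp
    fix u s'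
    assume *: "u \<le> t \<and> reg s' ''i'' = n - k \<and>
      I (Suc (n - k)) (set_reg ''i'' (Suc (n - k)) s')"
    have "n - (k - 1) = Suc (n - k)" using k 1 by linarith
    then show "runs R (IAssign ''i'' (IPlus (IReg ''i'') (IConst 1))) s'
        (\<lambda>v s'. u + v \<le> t + 4 \<and> k - 1 \<le> n \<and> I (n - (k - 1)) s')"
      using * 1 by (intro runs_IAssign[OF refl]) auto
  qed
  then show ?case using k by blast
next
  case 2
  then show ?case using init by simp
next
  case (3 u k s')
  have "n - k = n" using 3(2) 3(3) regs[of "n - k" s'] by auto
  then show ?case using 3 n by (intro post) (auto simp: algebra_simps)
qed

definition block :: "(nat \<Rightarrow> real) \<Rightarrow> nat \<Rightarrow> nat \<Rightarrow> real list" where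
  "block A d n = map (\<lambda>j. A (d + j)) [0..<n]"

definition fill :: "vname \<Rightarrow> iexp \<Rightarrow> rexp \<Rightarrow> com" where
  "fill a d e = for_n (RAssign a (IPlus d (IReg ''i'')) e)"

text \<open>The loop itself changes \<open>a\<close> and the counter, so offset and entries must
  evaluate as intended for arbitrary contents \<open>A\<close> of the target array.\<close>

lemma runs_fill:
  assumes n: "reg s ''n'' = n" "1 \<le> n"
    and d: "\<And>j A. ival d (set_arr a A (set_reg ''i'' j s)) = d'"
    and e: "\<And>j A. j < n \<Longrightarrow>
      rval e (set_arr a A (set_reg ''i'' j s)) = f j"
    and post: "\<And>u A. u \<le> (17 + icost d + rcost e) * n \<Longrightarrow> \<forall>j<n. A (d' + j) = f j \<Longrightarrow>
      \<forall>j. j < d' \<or> d' + n \<le> j \<longrightarrow> A j = arr s a j \<Longrightarrow>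
      \<Phi> u (set_arr a A (set_reg ''i'' n s))"
  shows "runs R (fill a d e) s \<Phi>"
proof -
  define I where "I = (\<lambda>j s'. \<exists>A. s' = set_arr a A (set_reg ''i'' j s) \<and>
    (\<forall>i<j. A (d' + i) = f i) \<and> (\<forall>i. i < d' \<or> d' + j \<le> i \<longrightarrow> A i = arr s a i))"
  show ?thesis
    unfolding fill_def
  proof (rule runs_for_n[where I = I and n = n and t = "3 + icost d + rcost e"])
    show "I 0 (set_reg ''i'' 0 s)"
      unfolding I_def by (auto intro!: exI[of _ "arr s a"] state_eqI)
    show "reg s' ''i'' = j \<and> reg s' ''n'' = n" if "I j s'" for j s'
      using that n by (auto simp: I_def)
    show "runs R (RAssign a (IPlus d (IReg ''i'')) e) s' (\<lambda>u s''. u \<le> 3 + icost d + rcost e \<and>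
        reg s'' ''i'' = j \<and> I (Suc j) (set_reg ''i'' (Suc j) s''))"
      if j: "j < n" and I: "I j s'" for j s'
    proof -
      obtain A where A: "s' = set_arr a A (set_reg ''i'' j s)"
        "\<forall>i<j. A (d' + i) = f i" "\<forall>i. i < d' \<or> d' + j \<le> i \<longrightarrow> A i = arr s a i"
        using I unfolding I_def by blast
      show ?thesis
        by (rule runs_RAssign[where k = "d' + j" and r = "f j"])
          (use A d e[OF j] in \<open>auto simp: I_def less_Suc_eq
            intro!: exI[of _ "A(d' + j := f j)"] state_eqI\<close>)
    qed
  next
    fix u s' assume "u \<le> (3 + icost d + rcost e + 14) * n" "I n s'"
    then show "\<Phi> u s'" using post unfolding I_def by (auto simp: algebra_simps)
  qed (rule n)
qed

definition cell :: "vname \<Rightarrow> rexp" where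
  "cell a = RCell a (IConst 0)"

definition set_cell :: "vname \<Rightarrow> rexp \<Rightarrow> com" where
  "set_cell a e = RAssign a (IConst 0) e"

lemma rval_cell [simp]: "rval (cell a) s = arr s a 0" "rcost (cell a) = 2"
  by (simp_all add: cell_def)

lemma runs_set_cell:
  assumes "rval e s = r" "\<Phi> (2 + rcost e) (set_entry a 0 r s)"
  shows "runs R (set_cell a e) s \<Phi>"
  unfolding set_cell_def by (rule runs_RAssign) (use assms in simp_all)

definition total :: "vname \<Rightarrow> int \<Rightarrow> rexp \<Rightarrow> com" where
  "total p k e = Seq (set_cell p (RConst k)) (for_n (set_cell p (RPlus (cell p) e)))"

lemma runs_total:
  assumes n: "reg s ''n'' = n" "1 \<le> n"
    and e: "\<And>j r. j < n \<Longrightarrow> rval e (set_entry p 0 r (set_reg ''i'' j s)) = f j"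
    and post: "\<And>u. u \<le> (22 + rcost e) * n \<Longrightarrow> \<Phi> u 
      (set_entry p 0 (of_int k + (\<Sum>j<n. f j)) (set_reg ''i'' n s))"
  shows "runs R (total p k e) s \<Phi>"
proof -
  define I where "I = (\<lambda>j s'. s' = set_entry p 0 (of_int k + (\<Sum>i<j. f i)) (set_reg ''i'' j s))"
  show ?thesis
    unfolding total_def
  proof (rule runs_Seq, rule runs_set_cell, rule refl,
      rule runs_for_n[where I = I and n = n and t = "5 + rcost e"])
    show "runs R (set_cell p (RPlus (cell p) e)) s' (\<lambda>u s''. u \<le> 5 + rcost e \<and>
        reg s'' ''i'' = j \<and> I (Suc j) (set_reg ''i'' (Suc j) s''))"
      if "j < n" "I j s'" for j s'
      by (rule runs_set_cell[OF refl])
        (use that e[OF that(1)] in \<open>auto simp: I_def add.assoc intro!: state_eqI\<close>)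
  next
    fix u s' assume u: "u \<le> (5 + rcost e + 14) * n" "I n s'"
    then have "2 + rcost (RConst k) + u \<le> (22 + rcost e) * n"
      using n(2) by (auto simp: algebra_simps)
    then show "\<Phi> (2 + rcost (RConst k) + u) s'"
      using post u(2) unfolding I_def by simp
  qed (use n in \<open>auto simp: I_def\<close>)
qed

text \<open>Started with an array \<open>x\<close> without binary entries, the subroutine has to change \<open>n\<close> cells.\<close>

lemma exec_basic_changes:
  assumes "exec_basic c s t s'"
  shows "finite {j. arr s' a j \<noteq> arr s a j} \<and> card {j. arr s' a j \<noteq> arr s a j} \<le> t"
proof -
  have trans: "finite {j. h j \<noteq> f j} \<and> card {j. h j \<noteq> f j} \<le> t + u"
    if "finite {j. g j \<noteq> f j} \<and> card {j. g j \<noteq> f j} \<le> t"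
      "finite {j. h j \<noteq> g j} \<and> card {j. h j \<noteq> g j} \<le> u" for f g h :: "nat \<Rightarrow> real" and t u
  proof -
    have sub: "{j. h j \<noteq> f j} \<subseteq> {j. g j \<noteq> f j} \<union> {j. h j \<noteq> g j}" by auto
    then have "card {j. h j \<noteq> f j} \<le> card ({j. g j \<noteq> f j} \<union> {j. h j \<noteq> g j})"
      using that by (intro card_mono) auto
    also have "\<dots> \<le> t + u" using that card_Un_le by (meson add_mono le_trans)
    finally show ?thesis using sub that by (auto intro: finite_subset)
  qed
  show ?thesis using assms
  proof (induction rule: exec.induct)
    case (exec_RAssign b i e s)
    have "{j. arr (s\<lparr>arr := (arr s)(b := (arr s b)(ival i s := rval e s))\<rparr>) a j \<noteq> arr s a j}
        \<subseteq> {ival i s}" (is "?D \<subseteq> _") by (auto split: if_splits)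
    then have "finite ?D" "card ?D \<le> card {ival i s}"
      by (auto intro: finite_subset card_mono simp del: card.insert)
    then show ?case by (intro conjI) (assumption, simp)
  next
    case (exec_Seq c s t s' d u s'')
    then show ?case using trans by blast
  next
    case (exec_WhileTrue b s c t s' u s'')
    then have "finite {j. arr s'' a j \<noteq> arr s a j} \<and> card {j. arr s'' a j \<noteq> arr s a j} \<le> t + u"
      using trans by blast
    then show ?case by simp
  qed auto
qed

text \<open>This allows the \<open>O(n)\<close> bookkeeping around each call of the subroutine to be
  charged to \<open>T\<close>.\<close>

lemma solves_nominal_time:
  assumes "solves_nominal Q n X T" "X \<subseteq> binary_vectors n"
  shows "n \<le> T"
proof -
  define s :: state where
    "s = \<lparr>reg = (\<lambda>_. n), arr = (\<lambda>a. if a = ''x'' then (\<lambda>_. 2) else (\<lambda>_. 0))\<rparr>"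
  have "reg s ''n'' = n \<and> vector_in s ''c'' n \<in> nonneg_vectors n"
    by (simp add: s_def vector_in_def nonneg_vectors_def)
  then obtain t s' where t: "exec_basic Q s t s'" "t \<le> T" "vector_in s' ''x'' n \<in> X"
    using assms(1) unfolding solves_nominal_def nominal_optimal_def is_arg_min_def by blast
  have "set (vector_in s' ''x'' n) \<subseteq> {0, 1}"
    using t(3) assms(2) by (auto simp: binary_vectors_def)
  then have "arr s' ''x'' j \<in> {0, 1}" if "j < n" for j
    using that unfolding vector_in_def by (simp add: image_subset_iff)
  moreover have "arr s ''x'' j \<notin> {0, 1}" for j by (simp add: s_def)
  ultimately have "arr s' ''x'' j \<noteq> arr s ''x'' j" if "j < n" for j using that by metis
  then have "{..<n} \<subseteq> {j. arr s' ''x'' j \<noteq> arr s ''x'' j}" (is "_ \<subseteq> ?D") by blast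
  moreover have D: "finite ?D" "card ?D \<le> t"
    using exec_basic_changes[OF t(1), of "''x''"] by simp_all
  ultimately have "card {..<n} \<le> card ?D" by (intro card_mono)
  then show ?thesis using D(2) t(2) by simp
qed

lemma runs_Solve:
  assumes "solves_nominal Q n X T" "reg s ''n'' = n" "block (arr s ''c'') 0 n = c"
    "c \<in> nonneg_vectors n"
    and "\<And>u A. u \<le> 1 + T \<Longrightarrow> nominal_optimal X c (block A 0 n) \<Longrightarrow>
      \<Phi> u (set_arr ''x'' A s)"
  shows "runs (exec_basic Q) Solve s \<Phi>"
proof -
  have "vector_in s a n = block (arr s a) 0 n" for s a
    by (simp add: vector_in_def block_def)
  then obtain t s' where "exec_basic Q s t s'" "t \<le> T"
    "nominal_optimal X c (block (arr s' ''x'') 0 n)"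
    using assms(1-4) unfolding solves_nominal_def by metis
  then show ?thesis
    using assms(5)[of "1 + t" "arr s' ''x''"]
    by (intro runsI[OF exec_Solve[where R = "exec_basic Q" and t = t and s' = s']]) (simp_all add: set_arr_def)
qed

subsection \<open>The sweep\<close>

definition weight :: "real list \<Rightarrow> nat" where
  "weight x = count_list x 1"

lemma sum_list_binary: "set x \<subseteq> {0, 1} \<Longrightarrow> sum_list x = real (weight x)"
  unfolding weight_def by (induction x) auto

lemma weight_le: "weight x \<le> length x"
  unfolding weight_def by (rule count_le_length)

lemma length_block [simp]: "length (block A d n) = n"
  by (simp add: block_def)

lemma nth_block [simp]: "j < n \<Longrightarrow> block A d n ! j = A (d + j)"
  by (simp add: block_def)

lemma block_eqI: "length x = n \<Longrightarrow> (\<And>j. j < n \<Longrightarrow> A (d + j) = x ! j) \<Longrightarrow> block A d n = x"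
  by (intro nth_equalityI) auto

lemma sum_block:
  assumes "block A d n = x" "x \<in> binary_vectors n"
  shows "(\<Sum>j<n. A (d + j)) = real (weight x)"
proof -
  have "(\<Sum>j<n. A (d + j)) = sum_list (block A d n)"
    by (simp add: block_def interv_sum_list_conv_sum_set_nat atLeast0LessThan)
  then show ?thesis using assms sum_list_binary by (auto simp: binary_vectors_def)
qed

lemma dot_block:
  assumes "block A d n = x"
  shows "(\<Sum>j<n. c ! j * A (d + j)) = dot c x"
  using assms by (auto simp: dot_def)

section \<open>Lists of vectors in consecutive blocks of an array\<close>

definition stores :: "(nat \<Rightarrow> real) \<Rightarrow> nat \<Rightarrow> real list list \<Rightarrow> bool" where
  "stores A n xs \<longleftrightarrow> (\<forall>i<length xs. block A (i * n) n = xs ! i)"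

lemma stores_append:
  assumes "stores A n xs" "\<And>j. j < length xs * n \<Longrightarrow> B j = A j" "block B (length xs * n) n = x"
  shows "stores B n (xs @ [x])"
  unfolding stores_def
proof (intro allI impI)
  fix i assume "i < length (xs @ [x])"
  then consider "i < length xs" | "i = length xs" by fastforce
  then show "block B (i * n) n = (xs @ [x]) ! i"
  proof cases
    case 1
    \<comment> \<open>Block \<open>i\<close> ends where block \<open>Suc i\<close> starts, hence
      below the cells that may differ.\<close>
    then have "Suc i * n \<le> length xs * n" by (intro mult_right_mono) auto
    then have "block B (i * n) n = block A (i * n) n"
      using assms(2) by (intro block_eqI) auto
    then show ?thesis using 1 assms(1) by (simp add: stores_def nth_append)
  qed (use assms(3) in simp)
qed

text \<open>Blocks are removed by lowering a register only; their stale contents may stay in the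
  array.\<close>

lemma stores_prefix: "stores A n (xs @ ys) \<Longrightarrow> stores A n xs"
  unfolding stores_def by (auto simp: nth_append split: if_splits)

lemma stores_nth: "stores A n xs \<Longrightarrow> i < length xs \<Longrightarrow> block A (i * n) n = xs ! i"
  by (simp add: stores_def)

lemma stores_last: "stores A n (xs @ [x]) \<Longrightarrow> block A (length xs * n) n = x"
  using stores_nth[of A n "xs @ [x]" "length xs"] by simp

text \<open>Arrays: \<open>d\<close> keeps the cost vector, \<open>c\<close> holds the shifted costs passed to the subroutine, \<open>K\<close> is the
  stack (register \<open>k\<close>: its first free cell) and \<open>S\<close> the output (register \<open>o\<close>: start of the block of the
  current solution). Scalars sit in cell \<open>0\<close> of an array: \<open>b\<close> the \<open>\<lambda>\<close> reached so far, \<open>e\<close> the optimum for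
  \<open>\<lambda> = 0\<close>, \<open>(p, q)\<close> and \<open>(u, v)\<close> the cost and slope of the current solution and of the top of the
  stack, \<open>l\<close> the \<open>\<lambda>\<close> where their lines meet, \<open>f\<close> the optimum there.\<close>

definition prelude :: com where
  "prelude =
     Seq (fill ''d'' (IConst 0) (RCell ''c'' (IReg ''i'')))
    (Seq (total ''b'' 1 (RCell ''d'' (IReg ''i'')))
    (Seq Solve
    (Seq (fill ''K'' (IConst 0) (RCell ''x'' (IReg ''i'')))
    (Seq (IAssign ''k'' (IReg ''n''))
    (Seq (total ''e'' 0 (RTimes (RCell ''d'' (IReg ''i'')) (RCell ''x'' (IReg ''i''))))
    (Seq (fill ''c'' (IConst 0) (RPlus (RCell ''d'' (IReg ''i'')) (cell ''b'')))
    (Seq Solve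
    (Seq (IAssign ''o'' (IConst 0))
    (Seq (IAssign ''m'' (IConst 1))
    (Seq (fill ''S'' (IReg ''o'') (RCell ''x'' (IReg ''i'')))
    (Seq (total ''p'' 0 (RTimes (RCell ''d'' (IReg ''i'')) (RCell ''x'' (IReg ''i''))))
         (total ''q'' 0 (RCell ''x'' (IReg ''i''))))))))))))))"

definition push :: com where
  "push = Seq (fill ''K'' (IReg ''k'') (RCell ''x'' (IReg ''i'')))
    (IAssign ''k'' (IPlus (IReg ''k'') (IReg ''n'')))"

text \<open>Advancing \<open>o\<close> and \<open>m\<close> decides the fate of the current
  solution: the top of the stack is then written either behind its block or over it.\<close>

definition confirm :: com where
  "confirm =
     Seq (Cond (RLess (cell ''l'') (cell ''b''))
       (Seq (IAssign ''o'' (IPlus (IReg ''o'') (IReg ''n'')))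
            (IAssign ''m'' (IPlus (IReg ''m'') (IConst 1)))) Skip)
    (Seq (IAssign ''k'' (IMinus (IReg ''k'') (IReg ''n'')))
    (Seq (fill ''S'' (IReg ''o'') (RCell ''K'' (IPlus (IReg ''k'') (IReg ''i''))))
    (Seq (set_cell ''b'' (cell ''l''))
    (Seq (set_cell ''p'' (cell ''u''))
         (set_cell ''q'' (cell ''v''))))))"

definition probe :: com where
  "probe =
     (let top = RCell ''K'' (IPlus (IMinus (IReg ''k'') (IReg ''n'')) (IReg ''i'')) in
     Seq (total ''u'' 0 (RTimes (RCell ''d'' (IReg ''i'')) top))
    (Seq (total ''v'' 0 top)
    (Seq (set_cell ''l'' (RDiv (RMinus (cell ''p'') (cell ''u'')) (RMinus (cell ''v'') (cell ''q''))))
    (Seq (fill ''c'' (IConst 0) (RPlus (RCell ''d'' (IReg ''i'')) (cell ''l'')))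
    (Seq Solve
         (total ''f'' 0 (RTimes (RCell ''c'' (IReg ''i'')) (RCell ''x'' (IReg ''i'')))))))))"

definition sweep :: com where
  "sweep = Seq prelude (While (RLess (cell ''e'') (cell ''p''))
    (Seq probe
      (Cond (RLess (cell ''f'') (RPlus (cell ''p'') (RTimes (cell ''l'') (cell ''q'')))) push confirm)))"

section \<open>Robust costs as lines with integral slopes\<close>

locale constant_growth =
  fixes n :: nat and X :: "real list set" and chat :: "real list" and Q :: com and T :: nat
  assumes n: "1 \<le> n" and X: "X \<noteq> {}" "X \<subseteq> binary_vectors n" and chat: "chat \<in> nonneg_vectors n"
    and Q: "solves_nominal Q n X T"
begin

sublocale parametric_min X "dot chat" weight .

lemma n_le_T: "n \<le> T"
  using solves_nominal_time[OF Q X(2)] .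

lemma length_X: "x \<in> X \<Longrightarrow> length x = n"
  using X(2) by (auto simp: binary_vectors_def)

lemma binary_X:
  assumes "x \<in> X" "j < n"
  shows "x ! j \<in> {0, 1}"
proof -
  have "length x = n" "set x \<subseteq> {0, 1}" using assms(1) X(2) by (auto simp: binary_vectors_def)
  then show ?thesis using assms(2) by (meson nth_mem subsetD)
qed

lemma chat_nonneg: "j < n \<Longrightarrow> 0 \<le> chat ! j"
  using chat by (auto simp: nonneg_vectors_def)

lemma sum_chat_nonneg: "0 \<le> (\<Sum>j<n. chat ! j)"
  using chat_nonneg by (intro sum_nonneg) simp

lemma dot_chat_nonneg: "x \<in> X \<Longrightarrow> 0 \<le> dot chat x"
  unfolding dot_def using binary_X chat_nonneg length_X by (intro sum_nonneg) fastforce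

lemma cost_eq_dot:
  assumes "x \<in> X" "\<And>j. j < n \<Longrightarrow> c ! j = chat ! j + \<theta>"
  shows "dot c x = cost \<theta> x"
proof -
  have len: "length x = n" "set x \<subseteq> {0, 1}" using assms(1) X(2) by (auto simp: binary_vectors_def)
  have "dot c x = (\<Sum>j<n. chat ! j * x ! j) + \<theta> * (\<Sum>j<n. x ! j)"
    using assms(2) len(1) by (simp add: dot_def algebra_simps sum.distrib sum_distrib_left)
  also have "(\<Sum>j<n. x ! j) = real (weight x)"
    using sum_list_binary[OF len(2)] len(1) by (simp add: sum_list_sum_nth atLeast0LessThan)
  finally show ?thesis using len(1) by (simp add: cost_def dot_def)
qed

lemma worst_case_cost_eq:
  assumes "x \<in> X" "0 \<le> \<theta>"
  shows "worst_case_cost (uncertainty_set chat (unit_box n) \<theta>) x = cost \<theta> x"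
proof -
  have len: "length x = n" "set x \<subseteq> {0, 1}" using assms(1) X(2) by (auto simp: binary_vectors_def)
  have lenc: "length chat = n" using chat by (simp add: nonneg_vectors_def)
  \<comment> \<open>The all-ones corner of the box is the worst case, because
    \<open>\<theta>\<close> and the entries of \<open>x\<close> are nonnegative.\<close>
  define top where "top = map2 (\<lambda>c b. c + \<theta> * b) chat (replicate n 1)"
  have top: "top \<in> uncertainty_set chat (unit_box n) \<theta>"
    unfolding top_def uncertainty_set_def by (auto simp: unit_box_def)
  have nth_top: "top ! j = chat ! j + \<theta>" if "j < n" for j
    using that lenc by (simp add: top_def)
  have "dot c x \<le> dot top x" if c: "c \<in> uncertainty_set chat (unit_box n) \<theta>" for c
  proof -
    obtain b where b: "c = map2 (\<lambda>c b. c + \<theta> * b) chat b" "b \<in> unit_box n"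
      using c by (auto simp: uncertainty_set_def)
    have "c ! j * x ! j \<le> top ! j * x ! j" if "j < n" for j
    proof (rule mult_right_mono)
      have "\<theta> * b ! j \<le> \<theta> * 1"
        using b(2) that assms(2) by (intro mult_left_mono) (auto simp: unit_box_def)
      then show "c ! j \<le> top ! j"
        using b lenc that by (simp add: nth_top unit_box_def)
      show "0 \<le> x ! j" using binary_X[OF assms(1) that] by auto
    qed
    then show ?thesis unfolding dot_def using len(1) by (intro sum_mono) auto
  qed
  then have "worst_case_cost (uncertainty_set chat (unit_box n) \<theta>) x = dot top x"
    unfolding worst_case_cost_def using top by (intro cSup_eq_maximum) auto
  then show ?thesis using cost_eq_dot[OF assms(1) nth_top] by simp
qed

lemma robust_optimal_iff:
  assumes "0 \<le> \<theta>"
  shows "robust_optimal X chat (unit_box n) \<theta> x \<longleftrightarrow> opt \<theta> x"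
  using worst_case_cost_eq[OF _ assms]
  unfolding robust_optimal_def is_arg_min_def opt_def by (auto simp: not_less)

lemma covers_all_sizes_iff:
  "covers_all_sizes X chat (unit_box n) S \<longleftrightarrow> S \<subseteq> X \<and> covers_from 0 S"
  unfolding covers_all_sizes_def covers_from_def using robust_optimal_iff by auto

text \<open>The robust problem of size \<open>\<theta>\<close> is the nominal problem with every
  cost raised by \<open>\<theta>\<close>, so the subroutine can solve it.\<close>

lemma nominal_optimal_opt:
  assumes "nominal_optimal X c x" "\<And>j. j < n \<Longrightarrow> c ! j = chat ! j + \<theta>"
  shows "opt \<theta> x"
  using assms cost_eq_dot[OF _ assms(2)]
  unfolding nominal_optimal_def is_arg_min_def opt_def by (auto simp: not_less)

lemma shifted_nonneg:
  assumes "length c = n" "\<And>j. j < n \<Longrightarrow> c ! j = chat ! j + \<theta>" "0 \<le> \<theta>"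
  shows "c \<in> nonneg_vectors n"
  using assms chat by (auto simp: nonneg_vectors_def)

text \<open>Nominal costs of feasible vectors lie between 0 and \<open>b - 1\<close>. At
  \<open>b\<close> a slope difference of 1 outweighs them, so exactly the minimal slope occurs among
  the optima.\<close>

lemma front_inv_large:
  assumes b: "b = 1 + (\<Sum>j<n. chat ! j)" and opt: "opt b x"
  shows "front_inv [] x b"
proof -
  have b_pos: "0 < b" using sum_chat_nonneg by (simp add: b)
  have less: "cost b y < cost b z" if "y \<in> X" "z \<in> X" "weight y < weight z" for y z
  proof -
    have "dot chat y \<le> (\<Sum>j<n. chat ! j)"
      unfolding dot_def length_X[OF \<open>y \<in> X\<close>]
      using binary_X[OF \<open>y \<in> X\<close>] chat_nonneg by (intro sum_mono) fastforce
    moreover have "0 \<le> dot chat z" using \<open>z \<in> X\<close> by (rule dot_chat_nonneg)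
    moreover have "b * real (Suc (weight y)) \<le> b * real (weight z)"
      using that b_pos by (intro mult_left_mono) auto
    ultimately show ?thesis by (simp add: cost_def b algebra_simps)
  qed
  show ?thesis
  proof (rule front_inv_init)
    show "0 < b" by (rule b_pos)
    show "weight x \<le> weight y" if "y \<in> X" for y
      using less[OF that opt_in[OF opt]] opt_le[OF opt that] by force
    show "weight x = weight z" if "opt b z" for z
      using less[OF opt_in[OF that] opt_in[OF opt]] less[OF opt_in[OF opt] opt_in[OF that]]
        opt_le[OF opt opt_in[OF that]] opt_le[OF that opt_in[OF opt]] by force
  qed (rule opt)
qed

lemma solution_of_front:
  assumes front: "front_inv L x b" and opt: "opt 0 x" and L: "set L \<subseteq> X"
  shows "variable_sized_solution X chat (unit_box n) (set (L @ [x]))"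
    and "card (set (L @ [x])) \<le> n"
proof -
  let ?S = "set (L @ [x])"
  have sorted: "sorted_wrt (\<lambda>y z. weight y < weight z) (L @ [x])"
    using front by (simp add: front_inv_def)
  have S: "?S \<subseteq> X" using L opt_in[OF opt] by simp
  \<comment> \<open>Finiteness rules out infinite competitors, whose \<open>card\<close> would be
    0.\<close>
  have fin: "finite (binary_vectors n)"
    unfolding binary_vectors_def
    using finite_lists_length_eq[of "{0, 1 :: real}" n] by (simp add: conj_commute)
  have min: "card ?S \<le> card A" if "A \<subseteq> X" "covers_from 0 A" for A
  proof (rule card_le_covering)
    show "essential y" if "y \<in> ?S" for y using front_inv_final(2)[OF front opt] that by blast
    show "inj_on weight ?S" using sorted_slopes_inj[OF sorted] by blast
    show "finite A" using that(1) X(2) fin by (meson finite_subset subset_trans)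
  qed (rule that(2))
  show "variable_sized_solution X chat (unit_box n) ?S"
    unfolding variable_sized_solution_def covers_all_sizes_iff
    using S front_inv_final(1)[OF front opt] min by blast
  show "card ?S \<le> n"
  proof (cases "\<exists>y\<in>X. weight y = 0")
    case True
    then obtain y where y: "y \<in> X" "weight y = 0" by blast
    have "1 \<notin> set y" using y(2) by (simp add: weight_def count_list_0_iff)
    then have "y ! j = 0" if "j < n" for j
      using binary_X[OF y(1) that] that length_X[OF y(1)] nth_mem by force
    \<comment> \<open>The zero vector costs 0 for every size, so it covers all sizes alone, and
      minimality leaves at most one element.\<close>
    then have "dot chat y = 0" by (simp add: dot_def length_X[OF y(1)])
    then have "covers_from 0 {y}"
      using y dot_chat_nonneg by (auto simp: covers_from_def opt_def cost_def)
    then show ?thesis using min[of "{y}"] y(1) n by simp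
  next
    case False
    then have "\<forall>y\<in>?S. 1 \<le> weight y \<and> weight y \<le> n"
      using S length_X weight_le by (metis One_nat_def Suc_leI not_gr_zero subsetD)
    then have "length (L @ [x]) \<le> Suc n - 1" using sorted_slopes_length[OF sorted] by blast
    then show ?thesis using card_length[of "L @ [x]"] by simp
  qed
qed

end

section \<open>Correctness and running time of the sweep\<close>

context constant_growth
begin

definition front_state :: "state \<Rightarrow> real list list \<Rightarrow> real list \<Rightarrow> real \<Rightarrow> bool" where
  "front_state s L x b \<longleftrightarrow> front_inv L x b \<and> set L \<subseteq> X \<and>
     reg s ''n'' = n \<and> (\<forall>j<n. arr s ''d'' j = chat ! j) \<and>
     (\<exists>x0. opt 0 x0 \<and> arr s ''e'' 0 = dot chat x0) \<and>
     arr s ''b'' 0 = b \<and> arr s ''p'' 0 = dot chat x \<and> arr s ''q'' 0 = weight x \<and>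
     reg s ''o'' = length L * n \<and> reg s ''m'' = Suc (length L) \<and>
     stores (arr s ''S'') n (L @ [x])"

definition stack_state :: "state \<Rightarrow> real list \<Rightarrow> real list list \<Rightarrow> bool" where
  "stack_state s x R \<longleftrightarrow> stack_inv x R \<and> reg s ''k'' = length R * n \<and> stores (arr s ''K'') n R"

text \<open>\<open>k\<close> bounds the potential of the overview, stated additively to avoid
  truncated subtraction. Once \<open>x\<close> is optimal at 0 nothing is asked of the stack, which
  may then be empty.\<close>

definition sweep_inv :: "nat \<Rightarrow> state \<Rightarrow> bool" where
  "sweep_inv k s \<longleftrightarrow> (\<exists>L x b. front_state s L x b \<and>
     (opt 0 x \<or> (\<exists>R. stack_state s x R \<and> 2 * n \<le> k + length R + 2 * weight x)))"

text \<open>Comparing two nominal values is how the loop test recognises that the sweep has reached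
  0.\<close>

lemma less_iff_not_opt:
  assumes "front_state s L x b"
  shows "arr s ''e'' 0 < arr s ''p'' 0 \<longleftrightarrow> \<not> opt 0 x"
proof -
  have x: "x \<in> X" "arr s ''p'' 0 = cost 0 x"
    using assms opt_in by (auto simp: front_state_def front_inv_def cost_def)
  obtain x0 where "opt 0 x0" "arr s ''e'' 0 = cost 0 x0"
    using assms by (auto simp: front_state_def cost_def)
  then show ?thesis using x opt_le opt_in opt_cong by (metis not_less)
qed

lemma runs_prelude:
  assumes s: "reg s ''n'' = n" "vector_in s ''c'' n = chat"
  shows "runs (exec_basic Q) prelude s (\<lambda>u s'. u \<le> 300 * T \<and> sweep_inv (2 * n) s')"
proof -
  have c: "arr s ''c'' j = chat ! j" if "j < n" for j
    using s(2) that by (auto simp: vector_in_def)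
  define b where "b = 1 + (\<Sum>j<n. chat ! j)"
  have b: "0 \<le> b" using sum_chat_nonneg by (simp add: b_def)
  show ?thesis
    unfolding prelude_def
    apply (rule runs_Seq, rule runs_fill[OF s(1) n, where d' = 0 and f = "(!) chat"])
      apply (simp_all add: c)[2]
    apply (rule runs_Seq, rule runs_total[OF _ n, where f = "(!) chat"])
       apply (simp_all add: s flip: b_def)[2]
    \<comment> \<open>The first call uses the unshifted costs and provides the bottom of the
      stack.\<close>
    apply (rule runs_Seq, rule runs_Solve[OF Q _ refl])
      apply (simp add: s)
     apply (rule shifted_nonneg[where \<theta> = 0]; simp add: c)
    apply (rule runs_Seq)
    subgoal for u1 D u2 u3 X0
      apply (rule runs_fill[OF _ n, where d' = 0 and f = X0])
         apply (simp_all add: s)[3]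
      apply (rule runs_Seq, rule runs_IAssign[where k = n], simp add: s)
      apply (rule runs_Seq, rule runs_total[OF _ n, where f = "\<lambda>j. chat ! j * X0 (0 + j)"])
         apply (simp_all add: s)[2]
      apply (rule runs_Seq, rule runs_fill[OF _ n, where d' = 0 and f = "\<lambda>j. chat ! j + b"])
          apply (simp_all add: s b_def)[3]
      \<comment> \<open>The second call uses costs shifted by \<open>b\<close> and provides the
        starting solution.\<close>
      apply (rule runs_Seq, rule runs_Solve[OF Q _ refl])
        apply (simp add: s)
       apply (rule shifted_nonneg[where \<theta> = b]; simp add: b)
      subgoal for u4 K u5 u6 C u7 X1
        apply (rule runs_Seq, rule runs_IAssign[where k = 0], simp)
        apply (rule runs_Seq, rule runs_IAssign[where k = 1], simp)
        apply (rule runs_Seq, rule runs_fill[OF _ n, where d' = 0 and f = X1])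
           apply (simp_all add: s)[3]
        apply (rule runs_Seq, rule runs_total[OF _ n, where f = "\<lambda>j. chat ! j * X1 (0 + j)"])
           apply (simp_all add: s)[2]
        apply (rule runs_total[OF _ n, where f = "\<lambda>j. X1 (0 + j)"])
           apply (simp_all add: s)[2]
        subgoal premises p for u8 S u9 u10
        proof
          show "u1 + (u2 + (u3 + (u4 + (1 + icost (IReg ''n'') + (u5 + (u6 + (u7 +
              (1 + icost (IConst 0) + (1 + icost (IConst 1) + (u8 + (u9 + u10))))))))))) \<le> 300 * T"
            using p(1,4,5,7,10,11,14,16,19,20) n n_le_T by simp
          let ?x0 = "block X0 0 n" and ?x1 = "block X1 0 n"
          have opt: "opt 0 ?x0" "opt b ?x1"
            using p(12) by (auto intro!: nominal_optimal_opt[OF p(6)] nominal_optimal_opt[OF p(15)]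
                simp: c)
          then have "?x1 \<in> binary_vectors n" using opt_in X(2) by blast
          note sums = sum_block[OF refl this] dot_block[OF refl, of chat X0 0 n]
            dot_block[OF refl, of chat X1 0 n]
          have front: "front_inv [] ?x1 b" by (rule front_inv_large[OF b_def opt(2)])
          have stores: "stores A n [block A' 0 n]" if "\<forall>j<n. A (0 + j) = A' j" for A A'
            using that by (auto simp: stores_def intro!: block_eqI)
          have stack: "stack_inv ?x1 [?x0]" if "\<not> opt 0 ?x1"
            using stack_inv_init[OF opt(2) _ opt(1) that] front by (simp add: front_inv_def)
          show "sweep_inv (2 * n) (set_entry ''q'' 0 (real_of_int 0 + (\<Sum>j<n. X1 (0 + j))) (set_reg ''i'' n
            (set_entry ''p'' 0 (real_of_int 0 + (\<Sum>j<n. chat ! j * X1 (0 + j))) (set_reg ''i'' n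
            (set_arr ''S'' S (set_reg ''i'' n (set_reg ''m'' 1 (set_reg ''o'' 0 (set_arr ''x'' X1
            (set_arr ''c'' C (set_reg ''i'' n
            (set_entry ''e'' 0 (real_of_int 0 + (\<Sum>j<n. chat ! j * X0 (0 + j))) (set_reg ''i'' n
            (set_reg ''k'' n (set_arr ''K'' K (set_reg ''i'' n (set_arr ''x'' X0
            (set_entry ''b'' 0 (real_of_int 1 + (\<Sum>j<n. chat ! j)) (set_reg ''i'' n
            (set_arr ''d'' D (set_reg ''i'' n s)))))))))))))))))))))" (is "sweep_inv _ ?s'")
          proof -
            have "arr ?s' ''e'' 0 = dot chat ?x0" "arr ?s' ''p'' 0 = dot chat ?x1"
              "arr ?s' ''q'' 0 = weight ?x1" "arr ?s' ''b'' 0 = b"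
              using sums by (simp_all add: b_def)
            moreover have "stores (arr ?s' ''S'') n ([] @ [?x1])" "stores (arr ?s' ''K'') n [?x0]"
              using stores[OF p(17)] stores[OF p(8)] by simp_all
            moreover have "\<forall>j<n. arr ?s' ''d'' j = chat ! j" using p(2) by simp
            moreover have "reg ?s' ''n'' = n" "reg ?s' ''k'' = n" "reg ?s' ''o'' = 0" "reg ?s' ''m'' = 1"
              using s(1) by simp_all
            ultimately have "front_state ?s' [] ?x1 b" "\<not> opt 0 ?x1 \<longrightarrow> stack_state ?s' ?x1 [?x0]"
              unfolding front_state_def stack_state_def using front stack opt(1)
              by (auto simp del: reg_set arr_set append_Nil)
            moreover have "2 * n \<le> 2 * n + length [?x0] + 2 * weight ?x1" by simp
            ultimately show ?thesis unfolding sweep_inv_def by blast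
          qed
        qed
        done
      done
    done
qed

lemma runs_probe:
  assumes front: "front_state s L x b" and stack: "stack_state s x R" and not_opt: "\<not> opt 0 x"
  shows "runs (exec_basic Q) probe s (\<lambda>u s'. u \<le> 200 * T \<and>
    front_state s' L x b \<and> stack_state s' x R \<and>
    arr s' ''u'' 0 = dot chat (last R) \<and> arr s' ''v'' 0 = weight (last R) \<and>
    arr s' ''l'' 0 = crossing x (last R) \<and>
    (\<exists>z. opt (crossing x (last R)) z \<and> block (arr s' ''x'') 0 n = z \<and>
       arr s' ''f'' 0 = cost (crossing x (last R)) z))"
proof -
  have inv: "front_inv L x b" "stack_inv x R" using front stack by (auto simp: front_state_def stack_state_def)
  note fs = front[unfolded front_state_def] and ss = stack[unfolded stack_state_def]
  have pos: "0 < crossing x (last R)" by (rule crossing_pos[OF inv not_opt])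
  \<comment> \<open>The cell at which the block of the top starts.\<close>
  define t where "t = length (butlast R) * n"
  have top: "block (arr s ''K'') t n = last R" "reg s ''k'' - n = t"
    using stores_last[of _ n "butlast R" "last R"] inv(2) ss by (auto simp: t_def stack_inv_def diff_mult_distrib)
  have "last R \<in> X" by (rule top_in_X[OF inv not_opt])
  then have sums: "(\<Sum>j<n. chat ! j * arr s ''K'' (t + j)) = dot chat (last R)"
    "(\<Sum>j<n. arr s ''K'' (t + j)) = weight (last R)"
    using dot_block[OF top(1)] sum_block[OF top(1)] X(2) by auto
  show ?thesis
    unfolding probe_def Let_def
    apply (rule runs_Seq, rule runs_total[OF _ n, where f = "\<lambda>j. chat ! j * arr s ''K'' (t + j)"])
       apply (simp_all add: fs top sums)[2]
    apply (rule runs_Seq, rule runs_total[OF _ n, where f = "\<lambda>j. arr s ''K'' (t + j)"])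
       apply (simp_all add: fs top sums)[2]
    apply (rule runs_Seq, rule runs_set_cell[where r = "crossing x (last R)"])
     apply (simp add: fs sums crossing_def)
    apply (rule runs_Seq, rule runs_fill[OF _ n, where d' = 0 and
          f = "\<lambda>j. chat ! j + crossing x (last R)"])
        apply (simp_all add: fs)[3]
    apply (rule runs_Seq, rule runs_Solve[OF Q _ refl])
      apply (simp add: fs)
     apply (rule shifted_nonneg[where \<theta> = "crossing x (last R)"]; simp add: less_imp_le[OF pos])
    subgoal for u1 u2 u3 C u4 A
      apply (rule runs_total[OF _ n, where f = "\<lambda>j. C j * A (0 + j)"])
        apply (simp_all add: fs)[2]
      subgoal premises p for u5
      proof -
        have opt: "opt (crossing x (last R)) (block A 0 n)"
          using p(4) by (intro nominal_optimal_opt[OF p(7)]) auto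
        then have "(\<Sum>j<n. C j * A (0 + j)) = cost (crossing x (last R)) (block A 0 n)"
          using p(4) dot_block[OF refl, of "block C 0 n" A 0 n]
            cost_eq_dot[OF opt_in, of _ _ "block C 0 n"] by auto
        then show ?thesis
          using p(1,2,3,6,8) n n_le_T fs ss opt sums
          by (simp add: front_state_def stack_state_def)
      qed
      done
    done
qed

lemma runs_push:
  assumes front: "front_state s L x b" and stack: "stack_state s x R"
    and z: "stack_inv x (R @ [z])" "block (arr s ''x'') 0 n = z"
  shows "runs (exec_basic Q) push s (\<lambda>u s'. u \<le> 40 * T \<and>
    front_state s' L x b \<and> stack_state s' x (R @ [z]))"
proof -
  note fs = front[unfolded front_state_def] and ss = stack[unfolded stack_state_def]
  show ?thesis
    unfolding push_def
    apply (rule runs_Seq, rule runs_fill[OF _ n, where d' = "length R * n" and f = "arr s ''x''"])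
       apply (simp_all add: fs ss)[3]
    apply (rule runs_IAssign[where k = "Suc (length R) * n"])
     apply (simp add: fs ss)
    subgoal premises p for u K
    proof -
      have "block K (length R * n) n = z"
        using p(2) z(2) by (intro block_eqI) auto
      then have "stores K n (R @ [z])"
        using ss p(3) by (intro stores_append[of "arr s ''K''"]) auto
      then show ?thesis
        using p(1) n n_le_T fs ss z by (auto simp: front_state_def stack_state_def)
    qed
    done
qed

lemma runs_confirm:
  assumes front: "front_state s L x b" and stack: "stack_state s x R" and not_opt: "\<not> opt 0 x"
    and cells: "arr s ''u'' 0 = dot chat (last R)" "arr s ''v'' 0 = weight (last R)"
      "arr s ''l'' 0 = crossing x (last R)"
    and no_better: "opt (crossing x (last R)) x"
  shows "runs (exec_basic Q) confirm s (\<lambda>u s'. u \<le> 80 * T \<and>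
    (\<exists>L'. front_state s' L' (last R) (crossing x (last R)) \<and>
       (opt 0 (last R) \<or> stack_state s' (last R) (butlast R))))"
proof -
  note fs = front[unfolded front_state_def] and ss = stack[unfolded stack_state_def]
  have inv: "front_inv L x b" "stack_inv x R" using fs ss by auto
  let ?y = "last R" and ?\<theta> = "crossing x (last R)"
  define t where "t = length (butlast R) * n"
  have R: "R = butlast R @ [?y]" using inv(2) by (simp add: stack_inv_def)
  have top: "block (arr s ''K'') t n = ?y" "reg s ''k'' - n = t"
    using stores_last[of _ n "butlast R" "last R"] inv(2) ss
    by (auto simp: t_def stack_inv_def diff_mult_distrib)
  have rest: "stores (arr s ''K'') n (butlast R)" using ss R stores_prefix by metis
  have x: "x \<in> X" using opt_in[OF no_better] .
  \<comment> \<open>Both branches are summarised by a list \<open>L'\<close>, which is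
    \<open>L @ [x]\<close> or \<open>L\<close>. Its blocks are already in \<open>S\<close>, so the
    remaining code is verified only once.\<close>
  have choose: "runs (exec_basic Q) (Cond (RLess (cell ''l'') (cell ''b''))
      (Seq (IAssign ''o'' (IPlus (IReg ''o'') (IReg ''n'')))
           (IAssign ''m'' (IPlus (IReg ''m'') (IConst 1)))) Skip) s
    (\<lambda>u s'. u \<le> 20 \<and> (\<exists>L'. front_inv L' ?y ?\<theta> \<and> set L' \<subseteq> X \<and> stores (arr s ''S'') n L' \<and>
       s' = set_reg ''o'' (length L' * n) (set_reg ''m'' (Suc (length L')) s)))"
  proof (rule runs_Cond)
    assume "bval (RLess (cell ''l'') (cell ''b'')) s"
    then have "front_inv (L @ [x]) ?y ?\<theta>"
      using front_inv_append[OF inv not_opt no_better] fs cells by simp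
    then show "runs (exec_basic Q) (Seq (IAssign ''o'' (IPlus (IReg ''o'') (IReg ''n'')))
           (IAssign ''m'' (IPlus (IReg ''m'') (IConst 1)))) s
      (\<lambda>u s'. 1 + bcost (RLess (cell ''l'') (cell ''b'')) + u \<le> 20 \<and>
        (\<exists>L'. front_inv L' ?y ?\<theta> \<and> set L' \<subseteq> X \<and> stores (arr s ''S'') n L' \<and>
        s' = set_reg ''o'' (length L' * n) (set_reg ''m'' (Suc (length L')) s)))"
      using fs x
      by (intro runs_Seq runs_IAssign[OF refl] conjI exI[of _ "L @ [x]"]) (auto intro!: state_eqI)
  next
    assume "\<not> bval (RLess (cell ''l'') (cell ''b'')) s"
    then have "front_inv L ?y ?\<theta>"
      using front_inv_replace[OF inv not_opt no_better] fs cells by simp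
    then show "runs (exec_basic Q) Skip s
      (\<lambda>u s'. 1 + bcost (RLess (cell ''l'') (cell ''b'')) + u \<le> 20 \<and>
        (\<exists>L'. front_inv L' ?y ?\<theta> \<and> set L' \<subseteq> X \<and> stores (arr s ''S'') n L' \<and>
        s' = set_reg ''o'' (length L' * n) (set_reg ''m'' (Suc (length L')) s)))"
      using fs stores_prefix[of _ _ L "[x]"]
      by (intro runs_Skip conjI exI[of _ L]) (auto intro!: state_eqI)
  qed
  show ?thesis
    unfolding confirm_def
  proof (rule runs_Seq, rule runs_mono[OF choose], elim conjE exE, hypsubst, goal_cases)
    case (1 u _ L')
    then show ?case
      apply -
      apply (rule runs_Seq, rule runs_IAssign[where k = t])
       apply (simp add: fs top)
      apply (rule runs_Seq, rule runs_fill[OF _ n, where d' = "length L' * n" and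
            f = "\<lambda>j. arr s ''K'' (t + j)"])
         apply (simp_all add: fs)[3]
      apply (rule runs_Seq, rule runs_set_cell[where r = "?\<theta>"])
       apply (simp add: cells)
      apply (rule runs_Seq, rule runs_set_cell[where r = "dot chat ?y"])
       apply (simp add: cells)
      apply (rule runs_set_cell[where r = "weight ?y"])
       apply (simp add: cells)
      subgoal premises p for v S
      proof -
        have "block S (length L' * n) n = block (arr s ''K'') t n"
          using p(6) by (intro block_eqI) auto
        then have "stores S n (L' @ [?y])"
          using p(4,7) top(1) by (intro stores_append[of "arr s ''S''"]) auto
        then show ?thesis
          using p fs n n_le_T rest stack_inv_pop[OF inv not_opt no_better]
          by (auto simp: front_state_def stack_state_def t_def intro!: exI[of _ L'])
      qed
      done
  qed
qed

text \<open>A push raises the stack by one. A confirmation lowers it by one, but raises the slope by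
  at least one, which counts twice; either way the potential falls.\<close>

lemma runs_step:
  assumes "sweep_inv k s" and less: "arr s ''e'' 0 < arr s ''p'' 0"
  shows "0 < k \<and> runs (exec_basic Q) (Seq probe
      (Cond (RLess (cell ''f'') (RPlus (cell ''p'') (RTimes (cell ''l'') (cell ''q''))))
        push confirm)) s (\<lambda>u s'. u \<le> 300 * T \<and> sweep_inv (k - 1) s')"
proof -
  obtain L x b R where front: "front_state s L x b" and not_opt: "\<not> opt 0 x"
    and stack: "stack_state s x R" and k: "2 * n \<le> k + length R + 2 * weight x"
    using assms less_iff_not_opt unfolding sweep_inv_def by metis
  let ?y = "last R" and ?\<theta> = "crossing x (last R)"
  have inv: "front_inv L x b" "stack_inv x R"
    using front stack by (auto simp: front_state_def stack_state_def)
  have x: "x \<in> X" using inv(1) opt_in by (auto simp: front_inv_def)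
  have R: "R \<noteq> []" "set R \<subseteq> X" "sorted_wrt (\<lambda>y z. weight y < weight z) (x # rev R)"
    using inv(2) opt_in by (auto simp: stack_inv_def)
  have "weight x \<le> weight y \<and> weight y \<le> n" if "y \<in> set (x # rev R)" for y
    using that R(2,3) x weight_le length_X by (auto intro: less_imp_le)
  then have "length (x # rev R) \<le> Suc n - weight x"
    using sorted_slopes_length[OF R(3)] by blast
  \<comment> \<open>Inserted into the bound on the potential, this gives
    \<open>k \<ge> length R \<ge> 1\<close>, as the loop rule demands.\<close>
  then have len: "length R + weight x \<le> n" "1 \<le> length R" using R(1) by (auto simp: Suc_le_eq)
  have y: "weight x < weight ?y" by (rule stack_slopes[OF inv not_opt top_in[OF inv not_opt]])
  have "runs (exec_basic Q) (Cond (RLess (cell ''f'') (RPlus (cell ''p'') (RTimes (cell ''l'') (cell ''q''))))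
        push confirm) s' (\<lambda>v s''. u + v \<le> 300 * T \<and> sweep_inv (k - 1) s'')"
    if s': "u \<le> 200 * T" "front_state s' L x b" "stack_state s' x R"
      "arr s' ''u'' 0 = dot chat ?y" "arr s' ''v'' 0 = weight ?y" "arr s' ''l'' 0 = ?\<theta>"
      "opt ?\<theta> z" "block (arr s' ''x'') 0 n = z" "arr s' ''f'' 0 = cost ?\<theta> z" for u s' z
  proof -
    let ?b = "RLess (cell ''f'') (RPlus (cell ''p'') (RTimes (cell ''l'') (cell ''q'')))"
    have b: "bval ?b s' \<longleftrightarrow> cost ?\<theta> z < cost ?\<theta> x"
      using s' by (simp add: front_state_def cost_def)
    show ?thesis
    proof (rule runs_Cond)
      assume "bval ?b s'"
      then have "stack_inv x (R @ [z])" using stack_inv_push[OF inv not_opt s'(7)] b by simp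
      note runs_push[OF s'(2,3) this s'(8)]
      then show "runs (exec_basic Q) push s'
          (\<lambda>v s''. u + (1 + bcost ?b + v) \<le> 300 * T \<and> sweep_inv (k - 1) s'')"
        by (rule runs_mono) (use s'(1) n n_le_T k len in
          \<open>auto simp: sweep_inv_def intro!: exI[of _ "R @ [z]"] exI\<close>)
    next
      assume "\<not> bval ?b s'"
      then have "opt ?\<theta> x" using opt_cong[OF s'(7) x] b by simp
      note confirm = runs_confirm[OF s'(2,3) not_opt s'(4-6) this]
      have "sweep_inv (k - 1) s''"
        if "front_state s'' L' ?y ?\<theta>" "opt 0 ?y \<or> stack_state s'' ?y (butlast R)" for s'' L'
      proof -
        have "2 * n \<le> k - 1 + length (butlast R) + 2 * weight ?y" using k len y by simp
        then show ?thesis using that unfolding sweep_inv_def by blast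
      qed
      with confirm show "runs (exec_basic Q) confirm s'
          (\<lambda>v s''. u + (1 + bcost ?b + v) \<le> 300 * T \<and> sweep_inv (k - 1) s'')"
        by (elim runs_mono) (use s'(1) n n_le_T in auto)
    qed
  qed
  then have "runs (exec_basic Q) (Seq probe
      (Cond (RLess (cell ''f'') (RPlus (cell ''p'') (RTimes (cell ''l'') (cell ''q''))))
        push confirm)) s (\<lambda>u s'. u \<le> 300 * T \<and> sweep_inv (k - 1) s')"
    using runs_probe[OF front stack not_opt] by (intro runs_Seq) (auto elim!: runs_mono)
  then show ?thesis using k len by linarith
qed

lemma runs_sweep:
  assumes "reg s ''n'' = n" "vector_in s ''c'' n = chat"
  shows "runs (exec_basic Q) sweep s (\<lambda>u s'. u \<le> 1200 * n * T \<and> (\<exists>S. outputs_set s' n S \<and>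
    variable_sized_solution X chat (unit_box n) S \<and> card S \<le> n))"
  unfolding sweep_def
proof (rule runs_Seq, rule runs_mono[OF runs_prelude[OF assms]], elim conjE,
    rule runs_While[where I = sweep_inv and k = "2 * n" and t = "300 * T"], goal_cases)
  case (1 u s k s')
  then show ?case using runs_step[of k s'] by simp
next
  case (2 u s)
  then show ?case by blast
next
  case (3 u s v k s')
  obtain L x b where front: "front_state s' L x b" using 3(5) by (auto simp: sweep_inv_def)
  note fs = front[unfolded front_state_def]
  have opt: "opt 0 x" using less_iff_not_opt[OF front] 3(4) by simp
  let ?S = "set (L @ [x])"
  have "distinct (L @ [x])"
    using fs sorted_slopes_inj[of "L @ [x]"] by (simp add: front_inv_def)
  then have "card ?S = reg s' ''m''" using fs by (simp add: distinct_card)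
  moreover have "?S = (\<lambda>i. map (\<lambda>j. arr s' ''S'' (i * n + j)) [0..<n]) ` {..<reg s' ''m''}"
  proof -
    have "?S = (\<lambda>i. (L @ [x]) ! i) ` {..<reg s' ''m''}"
      using fs by (metis (no_types, lifting) atLeast_upt length_append_singleton list.set_map map_nth)
    also have "\<dots> = (\<lambda>i. map (\<lambda>j. arr s' ''S'' (i * n + j)) [0..<n]) ` {..<reg s' ''m''}"
      using fs stores_nth[of "arr s' ''S''" n "L @ [x]"] by (intro image_cong) (auto simp: block_def)
    finally show ?thesis .
  qed
  ultimately have "outputs_set s' n ?S" by (simp add: outputs_set_def)
  moreover have "u + v \<le> 1200 * n * T"
  proof -
    have "T \<le> n * T" "n \<le> n * T" using n n_le_T by simp_all
    \<comment> \<open>At most \<open>2 * n\<close> rounds of \<open>300 * T\<close> steps and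
      \<open>2 * n + 1\<close> tests of 6 steps each.\<close>
    moreover have "v \<le> 600 * (n * T) + 12 * n + 6" using 3(3) by (simp add: algebra_simps)
    ultimately show ?thesis using 3(1) n by linarith
  qed
  ultimately show ?case using solution_of_front[of L x b] fs opt by blast
qed

end

theorem theorem5:
  shows "\<exists>P K. \<forall>n X chat Q T.
    1 \<le> n \<longrightarrow> X \<noteq> {} \<longrightarrow> X \<subseteq> binary_vectors n \<longrightarrow> chat \<in> nonneg_vectors n \<longrightarrow>
    solves_nominal Q n X T \<longrightarrow>
    (\<forall>s. reg s ''n'' = n \<and> vector_in s ''c'' n = chat \<longrightarrow>
      (\<exists>t s' S. exec (exec_basic Q) P s t s' \<and> t \<le> K * n * T \<and>
        outputs_set s' n S \<and>
        variable_sized_solution X chat (unit_box n) S \<and>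
        card S \<le> n))"
proof (rule exI[of _ sweep], rule exI[of _ 1200], intro allI impI)
  fix n X chat Q T s
  assume "1 \<le> n" "X \<noteq> {}" "X \<subseteq> binary_vectors n" "chat \<in> nonneg_vectors n"
    "solves_nominal Q n X T"
  then interpret constant_growth n X chat Q T by unfold_locales
  assume "reg s ''n'' = n \<and> vector_in s ''c'' n = chat"
  then show "\<exists>t s' S. exec (exec_basic Q) sweep s t s' \<and> t \<le> 1200 * n * T \<and>
      outputs_set s' n S \<and> variable_sized_solution X chat (unit_box n) S \<and> card S \<le> n"
    using runs_sweep unfolding runs_def by blast
qed

end
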